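(* Let $\Phi=[\phi_1,\dots,\phi_M]\in\mathbb{R}^{m\times M}$ be a unit norm frame for $\mathbb{R}^m$ with coherence $\mu(\Phi)$. Let $$D^{+}_{I_m}:=\{(i,j): 1\le i<j\le M,\ \phi_i^T\phi_j=\mu(\Phi)\},\qquad D^{-}_{I_m}:=\{(i,j): 1\le i<j\le M,\ \phi_i^T\phi_j=-\mu(\Phi)\},$$ put $\phi'_{ij}:=\frac{\phi_i\phi_j^T+\phi_j\phi_i^T}{2}$, and consider the matrix of size $m^2\times(M+|D^{+}_{I_m}|+|D^{-}_{I_m}|)$ $$\Psi=\Big[\big(\mathrm{vec}(\phi_i\phi_i^T)\big)_{i=1}^{M}\quad \big(\mathrm{vec}(\phi'_{ij})\big)_{(i,j)\in D^{+}_{I_m}}\quad -\big(\mathrm{vec}(\phi'_{ij})\big)_{(i,j)\in D^{-}_{I_m}}\Big].$$ If $\Psi$ has trivial nullspace, then there exists an invertible linear operator $\hat G\in\mathbb{R}^{m\times m}$ such that $\mu(\hat G\Phi)<\mu(\Phi)$.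
   Context: A family $\{\phi_i\}_{i=1}^M$ in $\mathbb{R}^m$ is a frame for $\mathbb{R}^m$ if there are constants $0<A\le B<\infty$ with $A\|z\|^2\le\sum_{i=1}^M|\langle z,\phi_i\rangle|^2\le B\|z\|^2$ for all $z\in\mathbb{R}^m$ (equivalently, the $m\times M$ matrix with columns $\phi_i$ has full row rank). It is identified with the matrix $\Phi=[\phi_1,\dots,\phi_M]$. It is a unit norm frame if $\|\phi_i\|_2=1$ for all $i$. The coherence of a frame $\Phi$ with nonzero columns (and $M\ge2$, so that the maximum is over a nonempty set) is $$\mu(\Phi)=\max_{1\le i,j\le M,\ i\ne j}\frac{|\phi_i^T\phi_j|}{\|\phi_i\|_2\|\phi_j\|_2}.$$ For an invertible $G\in\mathbb{R}^{m\times m}$, $G\Phi$ is the frame with columns $G\phi_1,\dots,G\phi_M$ (not necessarily of unit norm; the coherence is normalized). The operation $\mathrm{vec}$ applied to a $p\times q$ matrix gives the vector of length $pq$ obtained by stacking its columns vertically, one below the other. The columns of $\Psi$ are ordered in blocks: first the $M$ columns indexed by $i=1,\dots,M$, then those indexed by $D^{+}_{I_m}$, then those indexed by $D^{-}_{I_m}$ (each in a fixed order). *)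

theory Defs
  imports Complex_Main "Jordan_Normal_Form.Matrix_Kernel"
begin

(* A family phi_1, ..., phi_M in R^m is the m x M matrix Phi with these columns, so phi_(i+1) is
   "col Phi i": indices run over {0..<M} instead of {1..M}. *)

definition norm2 :: "real vec \<Rightarrow> real" where
  "norm2 v = sqrt (v \<bullet> v)"

definition is_frame :: "real mat \<Rightarrow> bool" where
  "is_frame \<Phi> \<longleftrightarrow> (\<exists>A B. 0 < A \<and> A \<le> B \<and>
     (\<forall>z \<in> carrier_vec (dim_row \<Phi>).
        A * (norm2 z)\<^sup>2 \<le> (\<Sum>i<dim_col \<Phi>. \<bar>z \<bullet> col \<Phi> i\<bar>\<^sup>2) \<and>
        (\<Sum>i<dim_col \<Phi>. \<bar>z \<bullet> col \<Phi> i\<bar>\<^sup>2) \<le> B * (norm2 z)\<^sup>2))"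

definition unit_norm_frame :: "real mat \<Rightarrow> bool" where
  "unit_norm_frame \<Phi> \<longleftrightarrow> is_frame \<Phi> \<and> (\<forall>i<dim_col \<Phi>. norm2 (col \<Phi> i) = 1)"

(* Only meaningful for at least two columns, all of them nonzero; otherwise the value is an artefact
   of the totalised Max and division. *)
definition coherence :: "real mat \<Rightarrow> real" where
  "coherence \<Phi> = Max {\<bar>col \<Phi> i \<bullet> col \<Phi> j\<bar> / (norm2 (col \<Phi> i) * norm2 (col \<Phi> j)) | i j.
     i < dim_col \<Phi> \<and> j < dim_col \<Phi> \<and> i \<noteq> j}"

definition D_plus :: "real mat \<Rightarrow> (nat \<times> nat) set" where
  "D_plus \<Phi> = {(i, j). i < j \<and> j < dim_col \<Phi> \<and> col \<Phi> i \<bullet> col \<Phi> j = coherence \<Phi>}"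

definition D_minus :: "real mat \<Rightarrow> (nat \<times> nat) set" where
  "D_minus \<Phi> = {(i, j). i < j \<and> j < dim_col \<Phi> \<and> col \<Phi> i \<bullet> col \<Phi> j = - coherence \<Phi>}"

(* u v^T *)
definition outer_prod :: "real vec \<Rightarrow> real vec \<Rightarrow> real mat" where
  "outer_prod u v = mat (dim_vec u) (dim_vec v) (\<lambda>(a, b). u $ a * v $ b)"

definition sym_outer :: "real mat \<Rightarrow> nat \<times> nat \<Rightarrow> real mat" where
  "sym_outer \<Phi> = (\<lambda>(i, j). (1 / 2) \<cdot>\<^sub>m
     (outer_prod (col \<Phi> i) (col \<Phi> j) + outer_prod (col \<Phi> j) (col \<Phi> i)))"

(* The vec operation: entry (a, b) of a p x q matrix goes to position b * p + a. *)
definition vectorize :: "real mat \<Rightarrow> real vec" where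
  "vectorize A = vec (dim_row A * dim_col A) (\<lambda>k. A $$ (k mod dim_row A, k div dim_row A))"

(* The lists ps and ns enumerate D_plus Phi and D_minus Phi; they fix the order of the columns
   inside the second and third blocks. *)
definition Psi :: "real mat \<Rightarrow> (nat \<times> nat) list \<Rightarrow> (nat \<times> nat) list \<Rightarrow> real mat" where
  "Psi \<Phi> ps ns = mat_of_cols ((dim_row \<Phi>)\<^sup>2)
     (map (\<lambda>i. vectorize (outer_prod (col \<Phi> i) (col \<Phi> i))) [0..<dim_col \<Phi>]
      @ map (\<lambda>p. vectorize (sym_outer \<Phi> p)) ps
      @ map (\<lambda>p. - vectorize (sym_outer \<Phi> p)) ns)"

lemma Psi_carrier:
  assumes "\<Phi> \<in> carrier_mat m M"
    and "distinct ps" "set ps = D_plus \<Phi>" "distinct ns" "set ns = D_minus \<Phi>"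
  shows "Psi \<Phi> ps ns \<in> carrier_mat (m\<^sup>2) (M + card (D_plus \<Phi>) + card (D_minus \<Phi>))"
proof -
  have "length ps = card (D_plus \<Phi>)" "length ns = card (D_minus \<Phi>)"
    using distinct_card[OF assms(2)] distinct_card[OF assms(4)] unfolding assms(3,5) by simp_all
  moreover have "dim_row \<Phi> = m" "dim_col \<Phi> = M"
    using assms(1) by (rule carrier_matD)+
  ultimately show ?thesis
    unfolding Psi_def by (intro carrier_matI)
      (simp_all only: mat_of_cols_carrier length_append length_map length_upt diff_zero add.assoc)
qed

end

theory Submission
  imports Defs
begin

text \<open>
  The proof is a first-order perturbation argument. For a matrix \<open>S\<close> and a small \<open>t > 0\<close> put
  \<open>G = I + t S\<close>. Then
    \<open>\<langle>G u, G v\<rangle> = \<langle>u, v\<rangle> + t (\<langle>u, S v\<rangle> + \<langle>S u, v\<rangle>) + t\<^sup>2 \<langle>S u, S v\<rangle>\<close>.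
  The columns of \<open>\<Psi>\<close> are the linear functionals \<open>S \<mapsto> \<langle>\<phi>\<^sub>i, S \<phi>\<^sub>i\<rangle>\<close> and
  \<open>S \<mapsto> \<plusminus> (\<langle>\<phi>\<^sub>i, S \<phi>\<^sub>j\<rangle> + \<langle>\<phi>\<^sub>j, S \<phi>\<^sub>i\<rangle>) / 2\<close>, the latter taken over the pairs that attain the coherence
  \<open>\<mu>\<close> with sign \<open>\<plusminus>\<close>. A trivial null space means that these functionals are independent, so their values
  can be prescribed: \<open>0\<close> on the first kind and \<open>-1\<close> on the second
  (lemma \<open>trivial_kernel_imp_transpose_surj\<close>). With this \<open>S\<close>,
  the squared norms of the \<open>G \<phi>\<^sub>i\<close> are \<open>1 + t\<^sup>2 \<parallel>S \<phi>\<^sub>i\<parallel>\<^sup>2 \<ge> 1\<close>, so the normalization in the coherence can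
  only help, while the extremal inner products \<open>\<plusminus>\<mu>\<close> move to \<open>\<plusminus>(\<mu> - 2 t + O(t\<^sup>2))\<close>. The other inner
  products stay strictly below \<open>\<mu>\<close> in absolute value by continuity, and \<open>det G \<rightarrow> 1\<close> as \<open>t \<rightarrow> 0\<close>. There
  are finitely many pairs, so one \<open>t\<close> serves them all.

  If \<open>\<mu> = 0\<close>, a pair \<open>i < j\<close> would be extremal with both signs, which contradicts the prescribed values;
  hence \<open>\<mu> > 0\<close>. Perturbing \<open>G\<close> itself rather than \<open>G\<^sup>T G\<close> gives an invertible matrix directly, and its
  second-order effect on the norms is a square, which has the favourable sign.
\<close>

section \<open>Linear systems and invertibility\<close>

lemma det_nonzero_imp_inverse:
  fixes A :: "'a :: field mat"
  assumes "A \<in> carrier_mat n n" and "det A \<noteq> 0"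
  obtains B where "B \<in> carrier_mat n n" "A * B = 1\<^sub>m n" "B * A = 1\<^sub>m n"
  using det_non_zero_imp_unit[OF assms, unfolded Units_def, of "()"] that
  by (auto simp: ring_mat_def)

text \<open>
  The Gram matrix \<open>A\<^sup>T A\<close> inherits the trivial kernel, because \<open>\<langle>v, A\<^sup>T A v\<rangle> = \<parallel>A v\<parallel>\<^sup>2\<close>. It is square, hence
  invertible, and \<open>A (A\<^sup>T A)\<^sup>-\<^sup>1\<close> is a right inverse of \<open>A\<^sup>T\<close>.
\<close>
lemma trivial_kernel_imp_transpose_surj:
  fixes A :: "real mat"
  assumes A: "A \<in> carrier_mat n k" and ker: "mat_kernel A = {0\<^sub>v k}" and b: "b \<in> carrier_vec k"
  obtains w where "w \<in> carrier_vec n" "A\<^sup>T *\<^sub>v w = b"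
proof -
  have AT: "A\<^sup>T \<in> carrier_mat k n" using A by simp
  have Gram: "A\<^sup>T * A \<in> carrier_mat k k" using A AT by simp
  have "det (A\<^sup>T * A) \<noteq> 0"
  proof
    assume "det (A\<^sup>T * A) = 0"
    then obtain v where v: "v \<in> carrier_vec k" "v \<noteq> 0\<^sub>v k" and eq: "(A\<^sup>T * A) *\<^sub>v v = 0\<^sub>v k"
      using det_0_iff_vec_prod_zero[OF Gram] by blast
    have Av: "A *\<^sub>v v \<in> carrier_vec n" using A v by simp
    have "(A *\<^sub>v v) \<bullet> (A *\<^sub>v v) = (A\<^sup>T *\<^sub>v (A *\<^sub>v v)) \<bullet> v"
      using transpose_vec_mult_scalar[OF A v(1) Av] by simp
    also have "\<dots> = 0\<^sub>v k \<bullet> v" using assoc_mult_mat_vec[OF AT A v(1)] eq by simp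
    also have "\<dots> = 0" using v by simp
    finally have "A *\<^sub>v v = 0\<^sub>v n" using conjugate_square_eq_0_vec[OF Av] by simp
    then have "v \<in> mat_kernel A" using mat_kernelI[OF A v(1)] by simp
    with ker v show False by simp
  qed
  then obtain B where B: "B \<in> carrier_mat k k" and inv: "(A\<^sup>T * A) * B = 1\<^sub>m k"
    using det_nonzero_imp_inverse[OF Gram] by blast
  have Bb: "B *\<^sub>v b \<in> carrier_vec k" using B b by simp
  show thesis
  proof (rule that)
    show "A *\<^sub>v (B *\<^sub>v b) \<in> carrier_vec n" using A Bb by simp
    have "A\<^sup>T *\<^sub>v (A *\<^sub>v (B *\<^sub>v b)) = (A\<^sup>T * A) *\<^sub>v (B *\<^sub>v b)"
      using assoc_mult_mat_vec[OF AT A Bb] by simp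
    also have "\<dots> = ((A\<^sup>T * A) * B) *\<^sub>v b" using assoc_mult_mat_vec[OF Gram B b] by simp
    finally show "A\<^sup>T *\<^sub>v (A *\<^sub>v (B *\<^sub>v b)) = b" using inv b by simp
  qed
qed

lemma det_nonzero_imp_invertible_mat:
  fixes A :: "'a :: field mat"
  assumes "A \<in> carrier_mat n n" and "det A \<noteq> 0"
  shows "invertible_mat A"
  using det_nonzero_imp_inverse[OF assms] assms(1)
  unfolding invertible_mat_def inverts_mat_def by (metis carrier_matD square_mat.simps)

lemma tendsto_det_perturbed_one:
  fixes S :: "real mat"
  assumes S: "S \<in> carrier_mat n n"
  shows "((\<lambda>t. det (1\<^sub>m n + t \<cdot>\<^sub>m S)) \<longlongrightarrow> 1) (at_right 0)"
proof -
  have entry: "((\<lambda>t. (1\<^sub>m n + t \<cdot>\<^sub>m S) $$ (i, j)) \<longlongrightarrow> 1\<^sub>m n $$ (i, j)) (at_right 0)"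
    if "i < n" "j < n" for i j
  proof -
    have "((\<lambda>t. 1\<^sub>m n $$ (i, j) + t * S $$ (i, j)) \<longlongrightarrow> 1\<^sub>m n $$ (i, j) + 0 * S $$ (i, j)) (at_right 0)"
      by (intro tendsto_intros)
    then show ?thesis using that S by simp
  qed
  have "((\<lambda>t. \<Sum>p | p permutes {0..<n}. signof p * (\<Prod>i = 0..<n. (1\<^sub>m n + t \<cdot>\<^sub>m S) $$ (i, p i)))
      \<longlongrightarrow> (\<Sum>p | p permutes {0..<n}. signof p * (\<Prod>i = 0..<n. 1\<^sub>m n $$ (i, p i)))) (at_right 0)"
    by (intro tendsto_sum tendsto_mult tendsto_const tendsto_prod entry)
       (auto simp: permutes_in_image[of _ "{0..<n}", simplified])
  moreover have "det (1\<^sub>m n + t \<cdot>\<^sub>m S) =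
      (\<Sum>p | p permutes {0..<n}. signof p * (\<Prod>i = 0..<n. (1\<^sub>m n + t \<cdot>\<^sub>m S) $$ (i, p i)))" for t
    using S by (intro det_def') simp
  moreover have "(\<Sum>p | p permutes {0..<n}. signof p * (\<Prod>i = 0..<n. 1\<^sub>m n $$ (i, p i))) = (1 :: real)"
    unfolding det_def'[OF one_carrier_mat, symmetric] by (rule det_one)
  ultimately show ?thesis by simp
qed

section \<open>The columns of Psi as functionals on matrices\<close>

lemma sum_div_mod:
  fixes f :: "nat \<Rightarrow> nat \<Rightarrow> 'a :: comm_monoid_add"
  shows "(\<Sum>k<m * n. f (k mod m) (k div m)) = (\<Sum>a<m. \<Sum>b<n. f a b)"
proof (cases "m = 0")
  case False
  have "b * m + a < m * n" if "a < m" "b < n" for a b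
  proof -
    have "b * m + a < Suc b * m" using that(1) by simp
    also have "\<dots> \<le> n * m" using that(2) by (intro mult_le_mono1) simp
    finally show ?thesis by (simp add: mult.commute)
  qed
  then have "(\<Sum>k<m * n. f (k mod m) (k div m)) = (\<Sum>(a, b)\<in>{..<m} \<times> {..<n}. f a b)"
    using False
    by (intro sum.reindex_bij_witness[where i = "\<lambda>(a, b). b * m + a" and j = "\<lambda>k. (k mod m, k div m)"])
       (auto simp: less_mult_imp_div_less mult.commute)
  then show ?thesis by (simp add: sum.cartesian_product)
qed simp

lemma vectorize_carrier:
  assumes "A \<in> carrier_mat m m"
  shows "vectorize A \<in> carrier_vec (m\<^sup>2)"
  unfolding vectorize_def carrier_matD[OF assms] power2_eq_square by (rule vec_carrier)

lemma outer_prod_carrier: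
  assumes "u \<in> carrier_vec m" and "v \<in> carrier_vec n"
  shows "outer_prod u v \<in> carrier_mat m n"
  unfolding outer_prod_def carrier_vecD[OF assms(1)] carrier_vecD[OF assms(2)] by (rule mat_carrier)

lemma sym_outer_carrier:
  assumes "\<Phi> \<in> carrier_mat m M"
  shows "sym_outer \<Phi> p \<in> carrier_mat m m"
proof -
  have "col \<Phi> i \<in> carrier_vec m" for i
    using assms col_dim[of \<Phi> i] by (simp only: carrier_matD)
  then have "outer_prod (col \<Phi> i) (col \<Phi> j) \<in> carrier_mat m m" for i j
    by (intro outer_prod_carrier)
  then show ?thesis
    unfolding sym_outer_def case_prod_unfold by simp
qed

text \<open>The Frobenius inner product \<open>\<langle>u v\<^sup>T, S\<rangle>\<close> equals \<open>u\<^sup>T S v\<close>, here with \<open>S\<close> read off from its vectorization \<open>w\<close>.\<close>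
lemma vectorize_outer_prod_scalar:
  assumes u: "u \<in> carrier_vec m" and v: "v \<in> carrier_vec m" and w: "w \<in> carrier_vec (m\<^sup>2)"
  shows "vectorize (outer_prod u v) \<bullet> w = u \<bullet> (mat m m (\<lambda>(a, b). w $ (b * m + a)) *\<^sub>v v)"
proof -
  have "vectorize (outer_prod u v) \<bullet> w = (\<Sum>k<m * m. u $ (k mod m) * v $ (k div m) * w $ k)"
  proof -
    have "k mod m < m" "k div m < m" if "k < m * m" for k
      using that by (auto simp: less_mult_imp_div_less intro!: mod_less_divisor gr0I)
    then show ?thesis
      using assms unfolding scalar_prod_def vectorize_def outer_prod_def
      by (intro sum.cong) (auto simp: power2_eq_square)
  qed
  also have "\<dots> = (\<Sum>k<m * m. u $ (k mod m) * v $ (k div m) * w $ (k div m * m + k mod m))"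
    by simp
  also have "\<dots> = (\<Sum>a<m. \<Sum>b<m. u $ a * v $ b * w $ (b * m + a))"
    by (rule sum_div_mod)
  also have "\<dots> = u \<bullet> (mat m m (\<lambda>(a, b). w $ (b * m + a)) *\<^sub>v v)"
    using u v unfolding scalar_prod_def
    by (simp add: scalar_prod_def sum_distrib_left atLeast0LessThan ac_simps)
  finally show ?thesis .
qed

lemma vectorize_sym_outer_scalar:
  assumes \<Phi>: "\<Phi> \<in> carrier_mat m M" and w: "w \<in> carrier_vec (m\<^sup>2)" and ij: "i < M" "j < M"
  defines "S \<equiv> mat m m (\<lambda>(a, b). w $ (b * m + a))"
  shows "vectorize (sym_outer \<Phi> (i, j)) \<bullet> w =
    (col \<Phi> i \<bullet> (S *\<^sub>v col \<Phi> j) + col \<Phi> j \<bullet> (S *\<^sub>v col \<Phi> i)) / 2"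
proof -
  let ?u = "col \<Phi> i" and ?v = "col \<Phi> j"
  have u: "?u \<in> carrier_vec m" and v: "?v \<in> carrier_vec m" using \<Phi> by auto
  have eq: "vectorize (sym_outer \<Phi> (i, j)) =
      (1 / 2) \<cdot>\<^sub>v (vectorize (outer_prod ?u ?v) + vectorize (outer_prod ?v ?u))"
  proof (rule eq_vecI)
    fix k assume "k < dim_vec ((1 / 2) \<cdot>\<^sub>v (vectorize (outer_prod ?u ?v) + vectorize (outer_prod ?v ?u)))"
    then have k: "k < m * m" using carrier_matD[OF \<Phi>] by (simp add: vectorize_def outer_prod_def)
    then have "k mod m < m" "k div m < m"
      by (auto simp: less_mult_imp_div_less intro!: mod_less_divisor gr0I)
    with k u v carrier_matD[OF \<Phi>] show "vectorize (sym_outer \<Phi> (i, j)) $ k =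
        ((1 / 2) \<cdot>\<^sub>v (vectorize (outer_prod ?u ?v) + vectorize (outer_prod ?v ?u))) $ k"
      by (simp add: vectorize_def outer_prod_def sym_outer_def)
  qed (use \<Phi> in \<open>simp add: vectorize_def outer_prod_def sym_outer_def\<close>)
  have "vectorize (outer_prod ?u ?v) \<in> carrier_vec (m\<^sup>2)" "vectorize (outer_prod ?v ?u) \<in> carrier_vec (m\<^sup>2)"
    by (intro vectorize_carrier outer_prod_carrier u v)+
  then show ?thesis
    using w vectorize_outer_prod_scalar[OF u v w] vectorize_outer_prod_scalar[OF v u w]
    unfolding eq S_def by (simp add: add_scalar_prod_distrib[of _ "m\<^sup>2"] smult_scalar_prod_distrib[of _ "m\<^sup>2"])
qed

text \<open>
  The direction of the perturbation: to first order, \<open>I + t S\<close> keeps the norms of the frame vectors and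
  shrinks every inner product that attains the coherence.
\<close>
lemma descent_direction:
  assumes \<Phi>: "\<Phi> \<in> carrier_mat m M"
    and ps: "distinct ps" "set ps = D_plus \<Phi>" and ns: "distinct ns" "set ns = D_minus \<Phi>"
    and ker: "mat_kernel (Psi \<Phi> ps ns) = {0\<^sub>v (M + card (D_plus \<Phi>) + card (D_minus \<Phi>))}"
  obtains S where "S \<in> carrier_mat m m"
    "\<And>i. i < M \<Longrightarrow> col \<Phi> i \<bullet> (S *\<^sub>v col \<Phi> i) = 0"
    "\<And>i j. (i, j) \<in> D_plus \<Phi> \<Longrightarrow> col \<Phi> i \<bullet> (S *\<^sub>v col \<Phi> j) + col \<Phi> j \<bullet> (S *\<^sub>v col \<Phi> i) = - 2"
    "\<And>i j. (i, j) \<in> D_minus \<Phi> \<Longrightarrow> col \<Phi> i \<bullet> (S *\<^sub>v col \<Phi> j) + col \<Phi> j \<bullet> (S *\<^sub>v col \<Phi> i) = 2"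
proof -
  let ?k = "M + card (D_plus \<Phi>) + card (D_minus \<Phi>)"
  define us where "us = map (\<lambda>i. vectorize (outer_prod (col \<Phi> i) (col \<Phi> i))) [0..<M]"
  define vs where "vs = map (\<lambda>p. vectorize (sym_outer \<Phi> p)) ps @ map (\<lambda>p. - vectorize (sym_outer \<Phi> p)) ns"
  define b :: "real vec" where "b = vec ?k (\<lambda>l. if l < M then 0 else - 1)"
  have dims: "dim_row \<Phi> = m" "dim_col \<Phi> = M" using \<Phi> by auto
  have Psi: "Psi \<Phi> ps ns = mat_of_cols (m\<^sup>2) (us @ vs)"
    unfolding Psi_def us_def vs_def dims by simp
  have carrier: "Psi \<Phi> ps ns \<in> carrier_mat (m\<^sup>2) ?k"
    by (rule Psi_carrier[OF \<Phi> ps ns])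
  obtain w where w: "w \<in> carrier_vec (m\<^sup>2)" and eq: "(Psi \<Phi> ps ns)\<^sup>T *\<^sub>v w = b"
    using trivial_kernel_imp_transpose_surj[OF carrier ker, of b] unfolding b_def by auto
  have sym_carrier: "vectorize (sym_outer \<Phi> p) \<in> carrier_vec (m\<^sup>2)" for p
    by (rule vectorize_carrier[OF sym_outer_carrier[OF \<Phi>]])
  have cols_carrier: "set (us @ vs) \<subseteq> carrier_vec (m\<^sup>2)"
  proof -
    have "col \<Phi> i \<in> carrier_vec m" for i using dims(1) col_dim[of \<Phi> i] by simp
    then have "vectorize (outer_prod (col \<Phi> i) (col \<Phi> i)) \<in> carrier_vec (m\<^sup>2)" for i
      by (intro vectorize_carrier outer_prod_carrier)
    then show ?thesis using sym_carrier unfolding us_def vs_def by auto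
  qed
  have len: "length us = M" "length (us @ vs) = ?k"
    using carrier unfolding Psi by (auto simp: us_def)
  have col_value: "(us @ vs) ! l \<bullet> w = (if l < M then 0 else - 1)" if l: "l < ?k" for l
  proof -
    have "(us @ vs) ! l \<in> carrier_vec (m\<^sup>2)"
      using cols_carrier l len(2) nth_mem[of l "us @ vs"] by (simp only: subset_iff)
    then have "col (Psi \<Phi> ps ns) l = (us @ vs) ! l"
      unfolding Psi using l len(2) by (intro col_mat_of_cols) simp_all
    then have "(us @ vs) ! l \<bullet> w = ((Psi \<Phi> ps ns)\<^sup>T *\<^sub>v w) $ l"
      using l carrier by simp
    then show ?thesis unfolding eq b_def using l by simp
  qed
  have us_value: "x \<bullet> w = 0" if x: "x \<in> set us" for x
  proof -
    obtain l where "l < M" "x = us ! l" using x len(1) unfolding in_set_conv_nth by auto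
    then show ?thesis using col_value[of l] len by (simp add: nth_append)
  qed
  have vs_value: "x \<bullet> w = - 1" if x: "x \<in> set vs" for x
  proof -
    obtain l where "l < length vs" "x = vs ! l" using x unfolding in_set_conv_nth by auto
    then show ?thesis using col_value[of "M + l"] len by (simp add: nth_append)
  qed
  define S where "S = mat m m (\<lambda>(a, b). w $ (b * m + a))"
  show thesis
  proof (rule that)
    show "S \<in> carrier_mat m m" unfolding S_def by simp
  next
    fix i assume i: "i < M"
    have "vectorize (outer_prod (col \<Phi> i) (col \<Phi> i)) \<bullet> w = 0"
      using i by (intro us_value) (auto simp: us_def)
    then show "col \<Phi> i \<bullet> (S *\<^sub>v col \<Phi> i) = 0"
      using vectorize_outer_prod_scalar[of "col \<Phi> i" m "col \<Phi> i" w] w dims unfolding S_def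
      by (metis col_dim)
  next
    fix i j assume ij: "(i, j) \<in> D_plus \<Phi>"
    then have "i < M" "j < M" unfolding D_plus_def dims by auto
    moreover have "vectorize (sym_outer \<Phi> (i, j)) \<bullet> w = - 1"
      using ij ps by (intro vs_value) (auto simp: vs_def)
    ultimately show "col \<Phi> i \<bullet> (S *\<^sub>v col \<Phi> j) + col \<Phi> j \<bullet> (S *\<^sub>v col \<Phi> i) = - 2"
      using vectorize_sym_outer_scalar[OF \<Phi> w] unfolding S_def by simp
  next
    fix i j assume ij: "(i, j) \<in> D_minus \<Phi>"
    then have "i < M" "j < M" unfolding D_minus_def dims by auto
    moreover have "(- vectorize (sym_outer \<Phi> (i, j))) \<bullet> w = - 1"
      using ij ns by (intro vs_value) (auto simp: vs_def)
    then have "vectorize (sym_outer \<Phi> (i, j)) \<bullet> w = 1"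
      using uminus_scalar_prod[OF sym_carrier w, of "(i, j)"] by linarith
    ultimately show "col \<Phi> i \<bullet> (S *\<^sub>v col \<Phi> j) + col \<Phi> j \<bullet> (S *\<^sub>v col \<Phi> i) = 2"
      using vectorize_sym_outer_scalar[OF \<Phi> w] unfolding S_def by simp
  qed
qed

section \<open>Coherence under a small perturbation\<close>

lemma finite_coherence_values:
  "finite {\<bar>col \<Phi> i \<bullet> col \<Phi> j\<bar> / (norm2 (col \<Phi> i) * norm2 (col \<Phi> j)) | i j.
     i < dim_col \<Phi> \<and> j < dim_col \<Phi> \<and> i \<noteq> j}"
  by (rule finite_subset[of _ "(\<lambda>(i, j). \<bar>col \<Phi> i \<bullet> col \<Phi> j\<bar> / (norm2 (col \<Phi> i) * norm2 (col \<Phi> j))) `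
        ({..<dim_col \<Phi>} \<times> {..<dim_col \<Phi>})"]) auto

lemma abs_inner_le_coherence:
  assumes "unit_norm_frame \<Phi>" and "i < dim_col \<Phi>" "j < dim_col \<Phi>" "i \<noteq> j"
  shows "\<bar>col \<Phi> i \<bullet> col \<Phi> j\<bar> \<le> coherence \<Phi>"
proof -
  have "\<bar>col \<Phi> i \<bullet> col \<Phi> j\<bar> = \<bar>col \<Phi> i \<bullet> col \<Phi> j\<bar> / (norm2 (col \<Phi> i) * norm2 (col \<Phi> j))"
    using assms unfolding unit_norm_frame_def by simp
  then show ?thesis
    unfolding coherence_def using assms(2-4) by (intro Max_ge finite_coherence_values) blast
qed

text \<open>Norms at least one only lower the normalized inner products, so the unnormalized ones suffice for a bound.\<close>
lemma coherence_less:
  assumes "2 \<le> dim_col \<Psi>"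
    and norm: "\<And>i. i < dim_col \<Psi> \<Longrightarrow> 1 \<le> norm2 (col \<Psi> i)"
    and inner: "\<And>i j. i < j \<Longrightarrow> j < dim_col \<Psi> \<Longrightarrow> \<bar>col \<Psi> i \<bullet> col \<Psi> j\<bar> < c"
  shows "coherence \<Psi> < c"
proof -
  have "\<bar>col \<Psi> i \<bullet> col \<Psi> j\<bar> / (norm2 (col \<Psi> i) * norm2 (col \<Psi> j)) < c"
    if ij: "i < dim_col \<Psi>" "j < dim_col \<Psi>" "i \<noteq> j" for i j
  proof -
    have "1 \<le> norm2 (col \<Psi> i) * norm2 (col \<Psi> j)"
      using mult_mono[OF norm[OF ij(1)] norm[OF ij(2)]] norm[OF ij(1)] by simp
    then have "\<bar>col \<Psi> i \<bullet> col \<Psi> j\<bar> / (norm2 (col \<Psi> i) * norm2 (col \<Psi> j)) \<le> \<bar>col \<Psi> i \<bullet> col \<Psi> j\<bar>"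
      by (simp add: divide_le_eq mult_le_cancel_left1)
    also have "\<dots> < c"
    proof (cases "i < j")
      case True
      then show ?thesis using inner ij by blast
    next
      case False
      have "col \<Psi> i \<bullet> col \<Psi> j = col \<Psi> j \<bullet> col \<Psi> i"
        by (rule comm_scalar_prod[of _ "dim_row \<Psi>"]) auto
      then show ?thesis using inner[of j i] ij False by simp
    qed
    finally show ?thesis .
  qed
  moreover have "0 < dim_col \<Psi>" "1 < dim_col \<Psi>" "(0::nat) \<noteq> 1" using assms(1) by auto
  ultimately show ?thesis
    unfolding coherence_def by (subst Max_less_iff[OF finite_coherence_values]) blast+
qed

lemma inner_perturbed:
  fixes S :: "real mat"
  assumes S: "S \<in> carrier_mat m m" and u: "u \<in> carrier_vec m" and v: "v \<in> carrier_vec m"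
  defines "G \<equiv> \<lambda>t. 1\<^sub>m m + t \<cdot>\<^sub>m S"
  shows "(G t *\<^sub>v u) \<bullet> (G t *\<^sub>v v) =
    u \<bullet> v + t * (u \<bullet> (S *\<^sub>v v) + v \<bullet> (S *\<^sub>v u)) + t\<^sup>2 * ((S *\<^sub>v u) \<bullet> (S *\<^sub>v v))"
proof -
  have G: "G t *\<^sub>v x = x + t \<cdot>\<^sub>v (S *\<^sub>v x)" if "x \<in> carrier_vec m" for x
    using that S unfolding G_def
    by (intro eq_vecI) (auto simp: add_mult_distrib_mat_vec[of _ m m] smult_scalar_prod_distrib[of _ m])
  have Su: "S *\<^sub>v u \<in> carrier_vec m" and Sv: "S *\<^sub>v v \<in> carrier_vec m" using S u v by auto
  have "(S *\<^sub>v u) \<bullet> v = v \<bullet> (S *\<^sub>v u)" by (rule comm_scalar_prod[OF Su v])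
  then show ?thesis
    using u v Su Sv unfolding G[OF u] G[OF v]
    by (simp add: add_scalar_prod_distrib[of _ m] scalar_prod_add_distrib[of _ m]
        smult_scalar_prod_distrib[of _ m] scalar_prod_smult_distrib[of _ m]
        algebra_simps power2_eq_square)
qed

text \<open>
  At the extreme \<open>a = c\<close> the first-order term pushes inwards; the case \<open>a = - c\<close> reduces to it by
  negating all coefficients.
\<close>
lemma eventually_abs_quadratic_less:
  fixes a s q c :: real
  assumes a: "\<bar>a\<bar> \<le> c" and c: "0 < c" and "a = c \<Longrightarrow> s < 0" and "a = - c \<Longrightarrow> 0 < s"
  shows "\<forall>\<^sub>F t in at_right 0. \<bar>a + t * s + t\<^sup>2 * q\<bar> < c"
proof -
  have extremal: "\<forall>\<^sub>F t in at_right 0. \<bar>c + t * s + t\<^sup>2 * q\<bar> < c" if s: "s < 0" for s q :: real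
  proof -
    have "((\<lambda>t. s + t * q) \<longlongrightarrow> s + 0 * q) (at_right 0)" by (intro tendsto_intros)
    then have "\<forall>\<^sub>F t in at_right 0. s + t * q < 0" using s by (intro order_tendstoD(2)) auto
    moreover have "((\<lambda>t. c + t * s + t\<^sup>2 * q) \<longlongrightarrow> c + 0 * s + 0\<^sup>2 * q) (at_right 0)"
      by (intro tendsto_intros)
    then have "\<forall>\<^sub>F t in at_right 0. - c < c + t * s + t\<^sup>2 * q" using c by (intro order_tendstoD(1)) auto
    moreover have "\<forall>\<^sub>F t in at_right (0::real). 0 < t" by (rule eventually_at_right_less)
    ultimately show ?thesis
    proof eventually_elim
      case (elim t)
      then have "t * (s + t * q) < 0" by (simp add: mult_pos_neg)
      then have "c + t * s + t\<^sup>2 * q < c" by (simp add: algebra_simps power2_eq_square)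
      with elim show ?case by simp
    qed
  qed
  consider "a = c" | "a = - c" | "\<bar>a\<bar> < c" using a by linarith
  then show ?thesis
  proof cases
    case 1
    then show ?thesis using extremal assms(3) by simp
  next
    case 2
    then have "\<forall>\<^sub>F t in at_right 0. \<bar>c + t * (- s) + t\<^sup>2 * (- q)\<bar> < c"
      using assms(4) by (intro extremal) simp
    then show ?thesis
      by (rule eventually_mono) (simp add: 2 abs_if split: if_splits)
  next
    case 3
    have "((\<lambda>t. \<bar>a + t * s + t\<^sup>2 * q\<bar>) \<longlongrightarrow> \<bar>a + 0 * s + 0\<^sup>2 * q\<bar>) (at_right 0)"
      by (intro tendsto_intros)
    then show ?thesis using 3 by (intro order_tendstoD(2)) auto
  qed
qed

theorem mainTheorem2:
  fixes \<Phi> :: "real mat" and m M :: nat and ps ns :: "(nat \<times> nat) list"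
  assumes "\<Phi> \<in> carrier_mat m M" and "2 \<le> M"
    and "unit_norm_frame \<Phi>"
    and "distinct ps" and "set ps = D_plus \<Phi>"
    and "distinct ns" and "set ns = D_minus \<Phi>"
    and "mat_kernel (Psi \<Phi> ps ns) = {0\<^sub>v (M + card (D_plus \<Phi>) + card (D_minus \<Phi>))}"
  shows "\<exists>G. G \<in> carrier_mat m m \<and> invertible_mat G \<and> coherence (G * \<Phi>) < coherence \<Phi>"
proof -
  note \<Phi> = assms(1) and M = assms(2)
  let ?\<mu> = "coherence \<Phi>"
  have dims: "dim_row \<Phi> = m" "dim_col \<Phi> = M" using \<Phi> by auto
  have col: "col \<Phi> i \<in> carrier_vec m" for i using dims by auto
  obtain S where S: "S \<in> carrier_mat m m"
    and diag: "\<And>i. i < M \<Longrightarrow> col \<Phi> i \<bullet> (S *\<^sub>v col \<Phi> i) = 0"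
    and plus: "\<And>i j. (i, j) \<in> D_plus \<Phi> \<Longrightarrow>
      col \<Phi> i \<bullet> (S *\<^sub>v col \<Phi> j) + col \<Phi> j \<bullet> (S *\<^sub>v col \<Phi> i) = - 2"
    and minus: "\<And>i j. (i, j) \<in> D_minus \<Phi> \<Longrightarrow>
      col \<Phi> i \<bullet> (S *\<^sub>v col \<Phi> j) + col \<Phi> j \<bullet> (S *\<^sub>v col \<Phi> i) = 2"
    using descent_direction[OF \<Phi> assms(4-8)] by blast
  have le: "\<bar>col \<Phi> i \<bullet> col \<Phi> j\<bar> \<le> ?\<mu>" if "i < j" "j < M" for i j
    using that dims by (intro abs_inner_le_coherence assms) auto
  have pos: "0 < ?\<mu>"
  proof (rule ccontr)
    assume "\<not> 0 < ?\<mu>"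
    then have "?\<mu> = 0" "col \<Phi> 0 \<bullet> col \<Phi> 1 = 0" using le[of 0 1] M by auto
    then have "(0, 1) \<in> D_plus \<Phi>" "(0, 1) \<in> D_minus \<Phi>"
      using M dims by (auto simp: D_plus_def D_minus_def)
    then show False using plus[of 0 1] minus[of 0 1] by simp
  qed
  define G where "G = (\<lambda>t. 1\<^sub>m m + t \<cdot>\<^sub>m S)"
  have G: "G t \<in> carrier_mat m m" for t using S by (simp add: G_def)
  have inner: "(G t *\<^sub>v col \<Phi> i) \<bullet> (G t *\<^sub>v col \<Phi> j) = col \<Phi> i \<bullet> col \<Phi> j
      + t * (col \<Phi> i \<bullet> (S *\<^sub>v col \<Phi> j) + col \<Phi> j \<bullet> (S *\<^sub>v col \<Phi> i))
      + t\<^sup>2 * ((S *\<^sub>v col \<Phi> i) \<bullet> (S *\<^sub>v col \<Phi> j))" for t i j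
    unfolding G_def by (rule inner_perturbed[OF S col col])
  have "\<forall>\<^sub>F t in at_right 0. \<bar>(G t *\<^sub>v col \<Phi> i) \<bullet> (G t *\<^sub>v col \<Phi> j)\<bar> < ?\<mu>"
    if "i < j" "j < M" for i j
    unfolding inner using le[OF that] pos plus[of i j] minus[of i j] that dims
    by (intro eventually_abs_quadratic_less) (auto simp: D_plus_def D_minus_def)
  moreover have "finite {(i, j). i < j \<and> j < M}"
    by (rule finite_subset[of _ "{..<M} \<times> {..<M}"]) auto
  ultimately have "\<forall>\<^sub>F t in at_right 0. \<forall>p\<in>{(i, j). i < j \<and> j < M}.
      \<bar>(G t *\<^sub>v col \<Phi> (fst p)) \<bullet> (G t *\<^sub>v col \<Phi> (snd p))\<bar> < ?\<mu>"
    by (intro eventually_ball_finite) auto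
  moreover have "\<forall>\<^sub>F t in at_right 0. 0 < det (G t)"
    unfolding G_def by (rule order_tendstoD(1)[OF tendsto_det_perturbed_one[OF S]]) simp
  ultimately have "\<forall>\<^sub>F t in at_right 0. 0 < det (G t) \<and> (\<forall>p\<in>{(i, j). i < j \<and> j < M}.
      \<bar>(G t *\<^sub>v col \<Phi> (fst p)) \<bullet> (G t *\<^sub>v col \<Phi> (snd p))\<bar> < ?\<mu>)"
    by eventually_elim blast
  then obtain t where det: "0 < det (G t)"
    and less: "\<And>i j. i < j \<Longrightarrow> j < M \<Longrightarrow> \<bar>(G t *\<^sub>v col \<Phi> i) \<bullet> (G t *\<^sub>v col \<Phi> j)\<bar> < ?\<mu>"
    by (auto dest!: eventually_happens)
  have col_G: "col (G t * \<Phi>) i = G t *\<^sub>v col \<Phi> i" if "i < M" for i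
    using col_mult2[OF G \<Phi> that] .
  have "coherence (G t * \<Phi>) < ?\<mu>"
  proof (rule coherence_less)
    show "2 \<le> dim_col (G t * \<Phi>)" using M dims by simp
  next
    fix i assume "i < dim_col (G t * \<Phi>)"
    then have i: "i < M" using dims by simp
    have "sqrt (col \<Phi> i \<bullet> col \<Phi> i) = 1"
      using assms(3) i dims unfolding unit_norm_frame_def norm2_def by simp
    then have "(G t *\<^sub>v col \<Phi> i) \<bullet> (G t *\<^sub>v col \<Phi> i) = 1 + t\<^sup>2 * ((S *\<^sub>v col \<Phi> i) \<bullet> (S *\<^sub>v col \<Phi> i))"
      unfolding inner using diag[OF i] by simp
    moreover have "0 \<le> (S *\<^sub>v col \<Phi> i) \<bullet> (S *\<^sub>v col \<Phi> i)"
      using conjugate_square_ge_0_vec[of "S *\<^sub>v col \<Phi> i"] by simp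
    ultimately show "1 \<le> norm2 (col (G t * \<Phi>) i)"
      unfolding col_G[OF i] norm2_def by simp
  next
    fix i j assume "i < j" "j < dim_col (G t * \<Phi>)"
    then show "\<bar>col (G t * \<Phi>) i \<bullet> col (G t * \<Phi>) j\<bar> < ?\<mu>"
      using less dims by (simp add: col_G)
  qed
  moreover have "invertible_mat (G t)"
    using det by (intro det_nonzero_imp_invertible_mat[OF G]) simp
  ultimately show ?thesis using G by blast
qed

end
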